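(* Let $g_0$ be the round metric for $\mathbb{S}^2$. Then, the sum $w$ of spherical harmonics of degree less than or equal to $\ell$ has at most $8\,\ell^2$ nodal domains.
   Context: A spherical harmonic of degree $k$ on the unit sphere $\mathbb{S}^2\subset\mathbb{R}^3$ is the restriction to $\mathbb{S}^2$ of a (real) harmonic homogeneous polynomial of degree $k$ on $\mathbb{R}^3$; it is an eigenfunction of $-\Delta_{g_0}$, where $\Delta_{g_0}$ is the Laplace-Beltrami operator of $g_0$, with eigenvalue $k(k+1)$. The nodal domains of $w$ are the connected components of the complement in $\mathbb{S}^2$ of the zero set of $w$.
   Formalization: The formal theorem assumes ℓ ≥ 1; for ℓ = 0 the stated bound fails, since a nonzero constant has one nodal domain while 8·0² = 0. *)

theory Defs
  imports "HOL-Analysis.Analysis"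
begin

text \<open>The unit sphere of \<open>\<real>\<^sup>3\<close> is \<open>sphere (0 :: real ^ 3) 1\<close>. Functions on it are represented by
  functions on \<^typ>\<open>real ^ 3\<close>, of which only the values on the sphere matter.\<close>

definition partial_deriv :: "'n::finite \<Rightarrow> (real ^ 'n \<Rightarrow> real) \<Rightarrow> real ^ 'n \<Rightarrow> real" where
  "partial_deriv i f x = deriv (\<lambda>t. f (x + t *\<^sub>R axis i 1)) 0"

definition laplacian :: "(real ^ 'n::finite \<Rightarrow> real) \<Rightarrow> real ^ 'n \<Rightarrow> real" where
  "laplacian f x = (\<Sum>i\<in>UNIV. partial_deriv i (partial_deriv i f) x)"

text \<open>The zero polynomial is homogeneous of every degree. For \<open>k = 0\<close> the condition at \<open>t = 0\<close>
  says that \<open>p\<close> is constant, because \<^prop>\<open>(0::real) ^ 0 = 1\<close>.\<close>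

definition homogeneous_polynomial :: "nat \<Rightarrow> (real ^ 'n::finite \<Rightarrow> real) \<Rightarrow> bool" where
  "homogeneous_polynomial k p \<longleftrightarrow>
     real_polynomial_function p \<and> (\<forall>t x. p (t *\<^sub>R x) = t ^ k * p x)"

definition spherical_harmonic :: "nat \<Rightarrow> (real ^ 3 \<Rightarrow> real) \<Rightarrow> bool" where
  "spherical_harmonic k Y \<longleftrightarrow>
     (\<exists>p. homogeneous_polynomial k p \<and> (\<forall>x. laplacian p x = 0) \<and>
          (\<forall>x\<in>sphere 0 1. Y x = p x))"

definition nodal_domains :: "(real ^ 3 \<Rightarrow> real) \<Rightarrow> (real ^ 3) set set" where
  "nodal_domains w = components {x \<in> sphere 0 1. w x \<noteq> 0}"

end

theory Submission
  imports Defs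
begin

text \<open>
  The bound comes from the degree of \<open>w\<close>: on the sphere, \<open>w\<close> is a sum of restrictions of homogeneous
  polynomials of degree at most \<open>l\<close>. Unless \<open>w\<close> vanishes identically, pick a point \<open>p\<close> of the sphere
  with \<open>w p \<noteq> 0\<close> and project stereographically from \<open>p\<close>. After multiplication by
  \<open>(1 + u\<^sup>2 + v\<^sup>2) ^ l\<close>, which changes no zeros, \<open>w\<close> becomes a polynomial \<open>q\<close> in the planar coordinates
  \<open>u, v\<close>, of degree at most \<open>m = 2 * l\<close>
  (\<open>bivariate_poly_homogeneous_unproject\<close>).

  At most one nodal domain contains \<open>p\<close>. Because \<open>w p \<noteq> 0\<close>, the point \<open>p\<close> is not in the closure of
  any other nodal domain, so all the others are bounded in the plane. On the boundary of such a domain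
  \<open>q\<close> vanishes, while \<open>q\<close> has no zeros inside; so \<open>\<bar>q\<bar>\<close> peaks in the interior, and this
  survives a small perturbation: \<open>q + \<epsilon> * (u ^ (m + 1) + v ^ (m + 1))\<close> has a critical point in every one
  of finitely many domains once \<open>\<epsilon>\<close> is small (\<open>perturbed_critical_point_in_nodal_domain\<close>).

  The perturbation is chosen so that the equations for critical points have the form
  \<open>\<alpha> * u ^ m = A u v\<close>, \<open>\<alpha> * v ^ m = B u v\<close> with \<open>A\<close>, \<open>B\<close> of degree less than \<open>m\<close>. For such a pair
  Bezout's bound is elementary: modulo the equations every polynomial reduces to a combination of
  the \<open>m\<^sup>2\<close> monomials \<open>u ^ i * v ^ j\<close> with \<open>i, j < m\<close>, whereas polynomials realise every function on
  a finite set; hence there are at most \<open>m\<^sup>2\<close> solutions (\<open>card_common_zeros_le\<close>). Altogether there are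
  at most \<open>m\<^sup>2 + 1 = 4 * l\<^sup>2 + 1 \<le> 8 * l\<^sup>2\<close> nodal domains.
\<close>

section \<open>Polynomial functions of two real variables\<close>

text \<open>The span of the monomials of total degree at most \<open>n\<close>. Generating it one monomial at a time
  lets linear statements, such as the existence of a derivative or the vanishing of a linear
  functional, be checked on monomials by rule induction.\<close>

inductive bivariate_poly :: "nat \<Rightarrow> (real \<Rightarrow> real \<Rightarrow> real) \<Rightarrow> bool" for n where
  zero: "bivariate_poly n (\<lambda>u v. 0)"
| add_monom: "bivariate_poly n f \<Longrightarrow> i + j \<le> n \<Longrightarrow> bivariate_poly n (\<lambda>u v. c * u ^ i * v ^ j + f u v)"

lemma bivariate_poly_monom:
  "i + j \<le> n \<Longrightarrow> bivariate_poly n (\<lambda>u v. c * u ^ i * v ^ j)"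
  using add_monom[OF zero] by simp

lemma bivariate_poly_const: "bivariate_poly n (\<lambda>u v. c)"
  using bivariate_poly_monom[of 0 0 n c] by simp

lemma bivariate_poly_add:
  assumes "bivariate_poly n f" "bivariate_poly n g"
  shows "bivariate_poly n (\<lambda>u v. f u v + g u v)"
  using assms
proof (induction rule: bivariate_poly.induct)
  case (add_monom f i j c)
  then show ?case
    using bivariate_poly.add_monom[of n "\<lambda>u v. f u v + g u v" i j c] by (simp add: add.assoc)
qed simp

lemma bivariate_poly_sum:
  "(\<And>i. i \<in> A \<Longrightarrow> bivariate_poly n (f i)) \<Longrightarrow> bivariate_poly n (\<lambda>u v. \<Sum>i\<in>A. f i u v)"
  by (induction A rule: infinite_finite_induct)
    (auto intro: bivariate_poly.zero bivariate_poly_add)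

lemma bivariate_poly_monom_mult:
  assumes "bivariate_poly n f" "i + j + n \<le> k"
  shows "bivariate_poly k (\<lambda>u v. c * u ^ i * v ^ j * f u v)"
  using assms
proof (induction rule: bivariate_poly.induct)
  case zero
  show ?case using bivariate_poly.zero by simp
next
  case (add_monom f a b d)
  have "bivariate_poly k (\<lambda>u v. (c * d) * u ^ (i + a) * v ^ (j + b) + c * u ^ i * v ^ j * f u v)"
    using add_monom by (intro bivariate_poly.add_monom) auto
  then show ?case
    by (simp add: power_add algebra_simps)
qed

lemma bivariate_poly_mult:
  assumes "bivariate_poly m f" "bivariate_poly n g" "m + n \<le> k"
  shows "bivariate_poly k (\<lambda>u v. f u v * g u v)"
  using assms
proof (induction rule: bivariate_poly.induct)
  case zero
  show ?case using bivariate_poly.zero by simp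
next
  case (add_monom f a b d)
  have "bivariate_poly k (\<lambda>u v. d * u ^ a * v ^ b * g u v + f u v * g u v)"
    using add_monom by (intro bivariate_poly_add bivariate_poly_monom_mult[of n]) auto
  then show ?case
    by (simp add: algebra_simps)
qed

lemma bivariate_poly_power:
  "bivariate_poly m f \<Longrightarrow> bivariate_poly (m * k) (\<lambda>u v. f u v ^ k)"
  by (induction k) (auto intro: bivariate_poly_const bivariate_poly_mult)

lemma bivariate_poly_prod:
  assumes "finite A" "\<And>i. i \<in> A \<Longrightarrow> bivariate_poly m (f i)"
  shows "bivariate_poly (m * card A) (\<lambda>u v. \<Prod>i\<in>A. f i u v)"
  using assms
proof (induction A rule: finite_induct)
  case empty
  show ?case using bivariate_poly_const by simp
next
  case (insert i A)
  then show ?case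
    using bivariate_poly_mult[of m "f i" "m * card A" "\<lambda>u v. \<Prod>i\<in>A. f i u v"] by simp
qed

lemma bivariate_poly_swap: "bivariate_poly n f \<Longrightarrow> bivariate_poly n (\<lambda>u v. f v u)"
proof (induction rule: bivariate_poly.induct)
  case (add_monom f i j c)
  then have "bivariate_poly n (\<lambda>u v. c * u ^ j * v ^ i + f v u)"
    by (intro bivariate_poly.add_monom) auto
  then show ?case by (simp add: mult_ac)
qed (rule bivariate_poly.zero)

lemma continuous_on_bivariate_poly:
  assumes "bivariate_poly n f" "continuous_on S a" "continuous_on S b"
  shows "continuous_on S (\<lambda>x. f (a x) (b x))"
  using assms by (induction rule: bivariate_poly.induct) (auto intro!: continuous_intros)

lemma bivariate_poly_deriv_fst:
  assumes "bivariate_poly n f"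
  obtains f' where "bivariate_poly (n - 1) f'"
    "\<And>u v. ((\<lambda>u. f u v) has_real_derivative f' u v) (at u)"
proof -
  have "\<exists>f'. bivariate_poly (n - 1) f' \<and>
      (\<forall>u v. ((\<lambda>u. f u v) has_real_derivative f' u v) (at u))"
    using assms
  proof (induction rule: bivariate_poly.induct)
    case zero
    show ?case
      using bivariate_poly.zero by (intro exI[of _ "\<lambda>u v. 0"]) auto
  next
    case (add_monom f i j c)
    then obtain f' where f': "bivariate_poly (n - 1) f'"
      "\<And>u v. ((\<lambda>u. f u v) has_real_derivative f' u v) (at u)" by blast
    have "bivariate_poly (n - 1) (\<lambda>u v. (c * real i) * u ^ (i - 1) * v ^ j)"
    proof (cases "i = 0")
      case True
      then show ?thesis using bivariate_poly.zero by simp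
    next
      case False
      then show ?thesis using add_monom by (intro bivariate_poly_monom) auto
    qed
    from bivariate_poly_add[OF this f'(1)] f'(2) show ?case
      by (intro exI[of _ "\<lambda>u v. (c * real i) * u ^ (i - 1) * v ^ j + f' u v"])
        (auto intro!: derivative_eq_intros)
  qed
  then show ?thesis using that by blast
qed

lemma bivariate_poly_deriv_snd:
  assumes "bivariate_poly n f"
  obtains f' where "bivariate_poly (n - 1) f'"
    "\<And>u v. ((\<lambda>v. f u v) has_real_derivative f' u v) (at v)"
proof -
  obtain g where "bivariate_poly (n - 1) g"
    "\<And>v u. ((\<lambda>v. f u v) has_real_derivative g v u) (at v)"
    using bivariate_poly_deriv_fst[OF bivariate_poly_swap[OF assms]] by blast
  then show ?thesis
    using that[of "\<lambda>u v. g v u"] bivariate_poly_swap by blast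
qed

text \<open>A real polynomial function carries no degree, so the degree has to be recovered from
  homogeneity. The induction shows that \<open>p (t *\<^sub>R \<phi> u v)\<close> is a polynomial in \<open>t\<close> whose
  coefficient of \<open>t ^ k\<close> has degree at most \<open>e * k\<close> in \<open>u, v\<close>. For \<open>p\<close> homogeneous of degree \<open>d\<close> this
  polynomial is \<open>t ^ d * p (\<phi> u v)\<close>, and comparing the coefficients of \<open>t ^ d\<close> gives the bound.\<close>

lemma bivariate_poly_homogeneous_compose:
  fixes \<phi> :: "real \<Rightarrow> real \<Rightarrow> real ^ 'n::finite"
  assumes hom: "homogeneous_polynomial d p"
    and \<phi>: "\<And>f. bounded_linear f \<Longrightarrow> bivariate_poly e (\<lambda>u v. f (\<phi> u v))"
  shows "bivariate_poly (e * d) (\<lambda>u v. p (\<phi> u v))"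
proof -
  have "real_polynomial_function p"
    using hom by (simp add: homogeneous_polynomial_def)
  then have "\<exists>F. (\<forall>t u v. poly (F u v) t = p (t *\<^sub>R \<phi> u v)) \<and>
      (\<forall>k. bivariate_poly (e * k) (\<lambda>u v. coeff (F u v) k))"
  proof (induction rule: real_polynomial_function.induct)
    case (linear f)
    have "bivariate_poly (e * k) (\<lambda>u v. coeff [:0, f (\<phi> u v):] k)" for k
      using \<phi>[OF linear] bivariate_poly.zero
      by (cases k; cases "k - 1") (auto simp: coeff_pCons)
    then show ?case
      by (intro exI[of _ "\<lambda>u v. [:0, f (\<phi> u v):]"])
        (auto simp: linear.hyps bounded_linear.linear linear_cmul)
  next
    case (const c)
    have "bivariate_poly (e * k) (\<lambda>u v. coeff [:c:] k)" for k
      by (rule bivariate_poly_const)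
    then show ?case
      by (intro exI[of _ "\<lambda>u v. [:c:]"]) auto
  next
    case (add f g)
    then obtain F G where "\<And>t u v. poly (F u v) t = f (t *\<^sub>R \<phi> u v)"
      "\<And>k. bivariate_poly (e * k) (\<lambda>u v. coeff (F u v) k)"
      "\<And>t u v. poly (G u v) t = g (t *\<^sub>R \<phi> u v)"
      "\<And>k. bivariate_poly (e * k) (\<lambda>u v. coeff (G u v) k)"
      by blast
    then show ?case
      by (intro exI[of _ "\<lambda>u v. F u v + G u v"]) (auto intro: bivariate_poly_add)
  next
    case (mult f g)
    then obtain F G where FG: "\<And>t u v. poly (F u v) t = f (t *\<^sub>R \<phi> u v)"
      "\<And>k. bivariate_poly (e * k) (\<lambda>u v. coeff (F u v) k)"
      "\<And>t u v. poly (G u v) t = g (t *\<^sub>R \<phi> u v)"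
      "\<And>k. bivariate_poly (e * k) (\<lambda>u v. coeff (G u v) k)"
      by blast
    have "bivariate_poly (e * k) (\<lambda>u v. coeff (F u v * G u v) k)" for k
      unfolding coeff_mult
      by (intro bivariate_poly_sum bivariate_poly_mult[OF FG(2) FG(4)])
        (auto simp flip: add_mult_distrib2)
    with FG show ?case
      by (intro exI[of _ "\<lambda>u v. F u v * G u v"]) auto
  qed
  then obtain F where F: "\<And>t u v. poly (F u v) t = p (t *\<^sub>R \<phi> u v)"
    "\<And>k. bivariate_poly (e * k) (\<lambda>u v. coeff (F u v) k)"
    by blast
  have "F u v = monom (p (\<phi> u v)) d" for u v
  proof -
    have "poly (F u v) = poly (monom (p (\<phi> u v)) d)"
      using hom by (auto simp: F homogeneous_polynomial_def poly_monom mult.commute)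
    then show ?thesis by (simp add: poly_eq_poly_eq_iff)
  qed
  then show ?thesis
    using F(2)[of d] by simp
qed

section \<open>Counting the common zeros of a dominated pair of equations\<close>

text \<open>Gaussian elimination: one equation with a nonzero coefficient at \<open>s0\<close> is used to eliminate the
  unknown \<open>s0\<close> from the remaining equations.\<close>

lemma underdetermined_homogeneous_system:
  fixes a :: "'e \<Rightarrow> 's \<Rightarrow> real"
  assumes "finite E" "finite S" "card E < card S"
  obtains c where "\<exists>s\<in>S. c s \<noteq> 0" "\<And>e. e \<in> E \<Longrightarrow> (\<Sum>s\<in>S. c s * a e s) = 0"
proof -
  have "\<exists>c. (\<exists>s\<in>S. c s \<noteq> 0) \<and> (\<forall>e\<in>E. (\<Sum>s\<in>S. c s * a e s) = 0)"
    using assms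
  proof (induction E arbitrary: S a rule: finite_induct)
    case empty
    then have "S \<noteq> {}" by auto
    then show ?case by (intro exI[of _ "\<lambda>_. 1"]) auto
  next
    case (insert e E)
    show ?case
    proof (cases "\<forall>s\<in>S. a e s = 0")
      case True
      moreover have "card E < card S"
        using insert by simp
      then obtain c where "\<exists>s\<in>S. c s \<noteq> 0" "\<forall>e\<in>E. (\<Sum>s\<in>S. c s * a e s) = 0"
        using insert.IH[of S a] insert.prems by blast
      ultimately show ?thesis by (intro exI[of _ c]) auto
    next
      case False
      then obtain s0 where s0: "s0 \<in> S" "a e s0 \<noteq> 0" by blast
      define S' where "S' = S - {s0}"
      have S': "finite S'" "card E < card S'"
        using insert s0 by (auto simp: S'_def)
      obtain c where c: "\<exists>s\<in>S'. c s \<noteq> 0"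
        "\<And>e'. e' \<in> E \<Longrightarrow> (\<Sum>s\<in>S'. c s * (a e' s - a e' s0 * a e s / a e s0)) = 0"
        using insert.IH[of S' "\<lambda>e' s. a e' s - a e' s0 * a e s / a e s0", OF S'] by blast
      define c0 where "c0 = - (\<Sum>s\<in>S'. c s * a e s) / a e s0"
      have split: "(\<Sum>s\<in>S. (c(s0 := c0)) s * a e' s) = c0 * a e' s0 + (\<Sum>s\<in>S'. c s * a e' s)" for e'
        using insert.prems s0 unfolding S'_def
        by (subst sum.remove[of _ s0]) (auto intro!: sum.cong)
      have "(\<Sum>s\<in>S. (c(s0 := c0)) s * a e' s) = 0" if "e' \<in> insert e E" for e'
      proof (cases "e' = e")
        case True
        show ?thesis using s0 unfolding True split[of e] by (simp add: c0_def)
      next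
        case False
        with that have "(\<Sum>s\<in>S'. c s * a e' s - (a e' s0 / a e s0) * (c s * a e s)) = 0"
          using c(2)[of e'] by (simp add: algebra_simps)
        then have "(\<Sum>s\<in>S'. c s * a e' s) - (a e' s0 / a e s0) * (\<Sum>s\<in>S'. c s * a e s) = 0"
          by (simp only: sum_subtractf sum_distrib_left)
        then show ?thesis unfolding split[of e'] by (simp add: c0_def field_simps)
      qed
      moreover have "\<exists>s\<in>S. (c(s0 := c0)) s \<noteq> 0"
        using c(1) unfolding S'_def by auto
      ultimately show ?thesis by blast
    qed
  qed
  then show ?thesis using that by blast
qed

text \<open>If there were more than \<open>m\<^sup>2\<close> common zeros, some nonzero weight \<open>c\<close> on them would annihilate
  the \<open>m\<^sup>2\<close> monomials with both exponents less than \<open>m\<close>. The equations replace a factor \<open>u ^ m\<close>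
  or \<open>v ^ m\<close> by terms of lower degree, so by induction on the degree \<open>c\<close> annihilates all
  polynomials. But a polynomial that vanishes at all the zeros except one where \<open>c\<close> is
  nonzero is not annihilated.\<close>

lemma card_common_zeros_le:
  assumes A: "bivariate_poly (m - 1) A" and B: "bivariate_poly (m - 1) B"
    and m: "m > 0" and "\<alpha> \<noteq> 0" and S: "finite S"
    and zA: "\<And>u v. (u, v) \<in> S \<Longrightarrow> \<alpha> * u ^ m = A u v"
    and zB: "\<And>u v. (u, v) \<in> S \<Longrightarrow> \<alpha> * v ^ m = B u v"
  shows "card S \<le> m\<^sup>2"
proof (rule ccontr)
  assume "\<not> card S \<le> m\<^sup>2"
  then have "card ({..<m} \<times> {..<m}) < card S"
    by (simp add: card_cartesian_product power2_eq_square)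
  then obtain c where c: "\<exists>s\<in>S. c s \<noteq> 0"
    "\<And>e. e \<in> {..<m} \<times> {..<m} \<Longrightarrow> (\<Sum>s\<in>S. c s * (fst s ^ fst e * snd s ^ snd e)) = 0"
    using underdetermined_homogeneous_system[of "{..<m} \<times> {..<m}" S
        "\<lambda>e s. fst s ^ fst e * snd s ^ snd e"] S by auto
  define L where "L f = (\<Sum>s\<in>S. c s * f (fst s) (snd s))" for f :: "real \<Rightarrow> real \<Rightarrow> real"
  have L_cong: "L f = L g" if "\<And>u v. (u, v) \<in> S \<Longrightarrow> f u v = g u v" for f g
    unfolding L_def using that by (intro sum.cong) auto
  have L_scale: "L (\<lambda>u v. k * f u v) = k * L f" for k f
    unfolding L_def by (simp add: sum_distrib_left mult_ac)
  have L_extend: "L f = 0" if "bivariate_poly n f"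
    "\<And>i j. i + j \<le> n \<Longrightarrow> L (\<lambda>u v. u ^ i * v ^ j) = 0" for n f
    using that(1)
  proof (induction rule: bivariate_poly.induct)
    case zero
    show ?case by (simp add: L_def)
  next
    case (add_monom f i j k)
    have "L (\<lambda>u v. k * u ^ i * v ^ j + f u v) = k * L (\<lambda>u v. u ^ i * v ^ j) + L f"
      unfolding L_scale[symmetric] by (simp add: L_def sum.distrib algebra_simps)
    then show ?case using add_monom that(2) by simp
  qed
  have L_monom: "L (\<lambda>u v. u ^ i * v ^ j) = 0" for i j
  proof (induction "i + j" arbitrary: i j rule: less_induct)
    case less
    consider "i < m" "j < m" | "i \<ge> m" | "j \<ge> m" by linarith
    then show ?case
    proof cases
      case 1
      then show ?thesis using c(2)[of "(i, j)"] by (simp add: L_def)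
    next
      case 2
      have "L (\<lambda>u v. 1 * u ^ (i - m) * v ^ j * A u v) = 0"
        using 2 m by (intro L_extend[OF bivariate_poly_monom_mult[OF A order_refl]] less) auto
      moreover have "L (\<lambda>u v. \<alpha> * (u ^ i * v ^ j)) = L (\<lambda>u v. 1 * u ^ (i - m) * v ^ j * A u v)"
      proof (rule L_cong)
        fix u v assume "(u, v) \<in> S"
        moreover have "u ^ i = u ^ m * u ^ (i - m)"
          using 2 by (simp flip: power_add)
        ultimately show "\<alpha> * (u ^ i * v ^ j) = 1 * u ^ (i - m) * v ^ j * A u v"
          by (simp flip: zA)
      qed
      ultimately show ?thesis using \<open>\<alpha> \<noteq> 0\<close> by (simp add: L_scale)
    next
      case 3
      have "L (\<lambda>u v. 1 * u ^ i * v ^ (j - m) * B u v) = 0"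
        using 3 m by (intro L_extend[OF bivariate_poly_monom_mult[OF B order_refl]] less) auto
      moreover have "L (\<lambda>u v. \<alpha> * (u ^ i * v ^ j)) = L (\<lambda>u v. 1 * u ^ i * v ^ (j - m) * B u v)"
      proof (rule L_cong)
        fix u v assume "(u, v) \<in> S"
        moreover have "v ^ j = v ^ m * v ^ (j - m)"
          using 3 by (simp flip: power_add)
        ultimately show "\<alpha> * (u ^ i * v ^ j) = 1 * u ^ i * v ^ (j - m) * B u v"
          by (simp flip: zB)
      qed
      ultimately show ?thesis using \<open>\<alpha> \<noteq> 0\<close> by (simp add: L_scale)
    qed
  qed
  \<comment> \<open>A product of squared distances separates \<open>s0\<close> from the other points.\<close>
  obtain s0 where s0: "s0 \<in> S" "c s0 \<noteq> 0" using c(1) by blast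
  define g where "g u v = (\<Prod>s\<in>S - {s0}. (u - fst s)\<^sup>2 + (v - snd s)\<^sup>2)" for u v
  have "bivariate_poly 2 (\<lambda>u v. (u - a)\<^sup>2 + (v - b)\<^sup>2)" for a b
  proof -
    have "bivariate_poly 2 (\<lambda>u v. 1 * u ^ 2 * v ^ 0 + (1 * u ^ 0 * v ^ 2 + ((- 2 * a) * u ^ 1 * v ^ 0 +
        ((- 2 * b) * u ^ 0 * v ^ 1 + (a\<^sup>2 + b\<^sup>2)))))"
      by (intro bivariate_poly.add_monom bivariate_poly_const) auto
    moreover have "(u - a)\<^sup>2 + (v - b)\<^sup>2 = 1 * u ^ 2 * v ^ 0 + (1 * u ^ 0 * v ^ 2 + ((- 2 * a) * u ^ 1 * v ^ 0 +
        ((- 2 * b) * u ^ 0 * v ^ 1 + (a\<^sup>2 + b\<^sup>2))))" for u v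
      by (simp add: power2_eq_square algebra_simps)
    ultimately show ?thesis by presburger
  qed
  then have "bivariate_poly (2 * card (S - {s0})) g"
    unfolding g_def using S by (intro bivariate_poly_prod) auto
  then have "L g = 0"
    using L_extend L_monom by blast
  moreover have "L g = c s0 * g (fst s0) (snd s0)"
  proof -
    have "g (fst s) (snd s) = 0" if "s \<in> S - {s0}" for s
      unfolding g_def using that S by (intro prod_zero) auto
    then show ?thesis
      unfolding L_def using S s0 by (subst sum.remove[of _ s0]) auto
  qed
  moreover have "g (fst s0) (snd s0) \<noteq> 0"
    unfolding g_def using S by (auto simp: sum_power2_eq_zero_iff prod_eq_iff)
  ultimately show False using s0 by simp
qed

section \<open>Stereographic coordinates\<close>

text \<open>The pole \<open>p\<close> is prescribed by the function under study, so the coordinates of the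
  projection refer to an orthonormal basis with \<open>p\<close> as its last vector.\<close>

locale orthonormal_frame =
  fixes e1 e2 p :: "real ^ 3"
  assumes inner_frame [simp]: "e1 \<bullet> e1 = 1" "e2 \<bullet> e2 = 1" "p \<bullet> p = 1"
    "e1 \<bullet> e2 = 0" "e1 \<bullet> p = 0" "e2 \<bullet> p = 0" "e2 \<bullet> e1 = 0" "p \<bullet> e1 = 0" "p \<bullet> e2 = 0"
    and expansion: "\<And>x. x = (x \<bullet> e1) *\<^sub>R e1 + (x \<bullet> e2) *\<^sub>R e2 + (x \<bullet> p) *\<^sub>R p"

lemma orthonormal_frame_exists:
  fixes p :: "real ^ 3"
  assumes "p \<in> sphere 0 1"
  obtains e1 e2 where "orthonormal_frame e1 e2 p"
proof -
  have "norm p = norm (axis 3 1 :: real ^ 3)"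
    using assms by simp
  then obtain T where T: "orthogonal_transformation T" "T (axis 3 1 :: real ^ 3) = p"
    by (metis orthogonal_transformation_exists)
  have inner: "T x \<bullet> T y = x \<bullet> y" for x y
    using T(1) by (simp add: orthogonal_transformation_def)
  have lin: "linear T"
    using T(1) by (rule orthogonal_transformation_linear)
  have "orthonormal_frame (T (axis 1 1)) (T (axis 2 1)) (T (axis 3 1))"
  proof
    fix x :: "real ^ 3"
    obtain y where y: "x = T y"
      using orthogonal_transformation_surj[OF T(1)] by blast
    have "y = (y $ 1) *\<^sub>R axis 1 1 + (y $ 2) *\<^sub>R axis 2 1 + (y $ 3) *\<^sub>R axis 3 1"
      by (simp add: vec_eq_iff forall_3 axis_def)
    then have "T y = T ((y $ 1) *\<^sub>R axis 1 1 + (y $ 2) *\<^sub>R axis 2 1 + (y $ 3) *\<^sub>R axis 3 1)"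
      by simp
    also have "\<dots> = (y $ 1) *\<^sub>R T (axis 1 1) + (y $ 2) *\<^sub>R T (axis 2 1) + (y $ 3) *\<^sub>R T (axis 3 1)"
      by (simp add: linear_add[OF lin] linear_cmul[OF lin])
    finally have "x = (y $ 1) *\<^sub>R T (axis 1 1) + (y $ 2) *\<^sub>R T (axis 2 1) + (y $ 3) *\<^sub>R T (axis 3 1)"
      by (simp add: y)
    moreover have "x \<bullet> T (axis i 1) = y $ i" for i
      by (simp add: y inner inner_axis)
    ultimately show "x = (x \<bullet> T (axis 1 1)) *\<^sub>R T (axis 1 1) + (x \<bullet> T (axis 2 1)) *\<^sub>R T (axis 2 1) +
        (x \<bullet> T (axis 3 1)) *\<^sub>R T (axis 3 1)"
      by simp
  qed (simp_all add: inner inner_axis_axis)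
  then show ?thesis using that T(2) by simp
qed

context orthonormal_frame
begin

text \<open>The inverse of the stereographic projection from \<open>p\<close> is \<open>lift u v\<close> divided by its norm
  \<open>1 + u\<^sup>2 + v\<^sup>2\<close>. The numerator is kept as a separate function because it is polynomial in \<open>u, v\<close>.\<close>

definition lift :: "real \<Rightarrow> real \<Rightarrow> real ^ 3" where
  "lift u v = (2 * u) *\<^sub>R e1 + (2 * v) *\<^sub>R e2 + (u\<^sup>2 + v\<^sup>2 - 1) *\<^sub>R p"

definition unproject :: "real \<Rightarrow> real \<Rightarrow> real ^ 3" where
  "unproject u v = (1 / (1 + u\<^sup>2 + v\<^sup>2)) *\<^sub>R lift u v"

definition coord1 :: "real ^ 3 \<Rightarrow> real" where
  "coord1 x = (x \<bullet> e1) / (1 - x \<bullet> p)"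

definition coord2 :: "real ^ 3 \<Rightarrow> real" where
  "coord2 x = (x \<bullet> e2) / (1 - x \<bullet> p)"

lemma denominator_pos: "1 + u\<^sup>2 + v\<^sup>2 > (0 :: real)"
  by (simp add: add_pos_nonneg)

lemma lift_eq: "lift u v = (1 + u\<^sup>2 + v\<^sup>2) *\<^sub>R unproject u v"
  using denominator_pos[of u v] by (simp add: unproject_def)

lemma unproject_in_sphere: "unproject u v \<in> sphere 0 1"
proof -
  have "lift u v \<bullet> lift u v = (1 + u\<^sup>2 + v\<^sup>2)\<^sup>2"
    by (simp add: lift_def inner_simps power2_eq_square algebra_simps)
  then have "norm (lift u v) = 1 + u\<^sup>2 + v\<^sup>2"
    using denominator_pos[of u v] by (simp add: norm_eq_sqrt_inner)
  then show ?thesis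
    using denominator_pos[of u v] by (simp add: unproject_def)
qed

lemma coord_unproject: "coord1 (unproject u v) = u" "coord2 (unproject u v) = v"
proof -
  obtain r where r: "r > 0" "unproject u v = (1 / r) *\<^sub>R lift u v" "lift u v \<bullet> p = r - 2"
    using denominator_pos[of u v] by (simp add: unproject_def lift_def inner_simps)
  have "lift u v \<bullet> e1 = 2 * u" "lift u v \<bullet> e2 = 2 * v"
    by (simp_all add: lift_def inner_simps)
  moreover have "1 - unproject u v \<bullet> p = 2 / r"
    using r by (simp add: field_simps)
  ultimately show "coord1 (unproject u v) = u" "coord2 (unproject u v) = v"
    using r by (simp_all add: coord1_def coord2_def)
qed

lemma inner_pole_less_1:
  assumes "x \<in> sphere 0 1" "x \<noteq> p"
  shows "x \<bullet> p < 1"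
proof -
  have "x \<bullet> x = 1"
    using assms by (simp add: dot_square_norm)
  then have "(x - p) \<bullet> (x - p) = 2 - 2 * (x \<bullet> p)"
    by (simp add: inner_simps inner_commute)
  moreover have "(x - p) \<bullet> (x - p) > 0"
    using assms by simp
  ultimately show ?thesis by simp
qed

lemma unproject_coord:
  assumes "x \<in> sphere 0 1" "x \<noteq> p"
  shows "unproject (coord1 x) (coord2 x) = x"
proof -
  define a b c where abc: "a = x \<bullet> e1" "b = x \<bullet> e2" "c = x \<bullet> p"
  have c: "c < 1"
    using inner_pole_less_1[OF assms] by (simp add: abc)
  have x: "x = a *\<^sub>R e1 + b *\<^sub>R e2 + c *\<^sub>R p"
    unfolding abc by (rule expansion)
  have "x \<bullet> x = 1"
    using assms by (simp add: dot_square_norm)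
  then have sq: "a\<^sup>2 + b\<^sup>2 = (1 + c) * (1 - c)"
    unfolding x by (simp add: inner_simps power2_eq_square algebra_simps)
  have coords: "coord1 x = a / (1 - c)" "coord2 x = b / (1 - c)"
    by (simp_all add: coord1_def coord2_def abc)
  have r: "(coord1 x)\<^sup>2 + (coord2 x)\<^sup>2 = (1 + c) / (1 - c)"
  proof -
    have "(coord1 x)\<^sup>2 + (coord2 x)\<^sup>2 = (a\<^sup>2 + b\<^sup>2) / (1 - c)\<^sup>2"
      by (simp add: coords power_divide add_divide_distrib)
    then show ?thesis
      using c unfolding sq by (simp add: power2_eq_square)
  qed
  have d: "1 / (1 + (coord1 x)\<^sup>2 + (coord2 x)\<^sup>2) = (1 - c) / 2"
  proof -
    have "1 + (1 + c) / (1 - c) = 2 / (1 - c)"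
      using c by (simp add: field_simps)
    then have "1 + (coord1 x)\<^sup>2 + (coord2 x)\<^sup>2 = 2 / (1 - c)"
      using r by linarith
    then show ?thesis by simp
  qed
  have e: "(coord1 x)\<^sup>2 + (coord2 x)\<^sup>2 - 1 = 2 * c / (1 - c)"
    unfolding r using c by (simp add: field_simps)
  have "unproject (coord1 x) (coord2 x) = ((1 - c) / 2) *\<^sub>R
      ((2 * (a / (1 - c))) *\<^sub>R e1 + (2 * (b / (1 - c))) *\<^sub>R e2 + (2 * c / (1 - c)) *\<^sub>R p)"
    unfolding unproject_def lift_def d e by (simp add: coords)
  also have "\<dots> = x"
    using c by (simp add: x scaleR_right_distrib)
  finally show ?thesis .
qed

lemma continuous_on_unproject:
  assumes "continuous_on S f" "continuous_on S g"
  shows "continuous_on S (\<lambda>t. unproject (f t) (g t))"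
  unfolding unproject_def lift_def
  using denominator_pos by (intro continuous_intros assms) (auto simp: less_imp_neq[symmetric])

lemma continuous_on_coord:
  assumes "K \<subseteq> sphere 0 1" "p \<notin> K"
  shows "continuous_on K coord1" "continuous_on K coord2"
  unfolding coord1_def coord2_def
  using assms inner_pole_less_1 by (intro continuous_intros; force)+

lemma bivariate_poly_linear_lift:
  assumes "bounded_linear f"
  shows "bivariate_poly 2 (\<lambda>u v. f (lift u v))"
proof -
  interpret bounded_linear f by fact
  have "bivariate_poly 2 (\<lambda>u v. (2 * f e1) * u ^ 1 * v ^ 0 + ((2 * f e2) * u ^ 0 * v ^ 1 +
      (f p * u ^ 2 * v ^ 0 + (f p * u ^ 0 * v ^ 2 + (- f p)))))"
    by (intro bivariate_poly.add_monom bivariate_poly_const) auto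
  moreover have "f (lift u v) = (2 * f e1) * u ^ 1 * v ^ 0 + ((2 * f e2) * u ^ 0 * v ^ 1 +
      (f p * u ^ 2 * v ^ 0 + (f p * u ^ 0 * v ^ 2 + (- f p))))" for u v
    by (simp add: lift_def add diff scaleR) (simp add: algebra_simps)
  ultimately show ?thesis by presburger
qed

text \<open>By homogeneity, \<open>d\<close> of the \<open>l\<close> factors \<open>1 + u\<^sup>2 + v\<^sup>2\<close> turn \<open>f (unproject u v)\<close> into
  \<open>f (lift u v)\<close>, of degree at most \<open>2 * d\<close>; the others contribute \<open>2 * (l - d)\<close>. Thus one power
  of \<open>1 + u\<^sup>2 + v\<^sup>2\<close> clears the denominators for all degrees up to \<open>l\<close> at once.\<close>

lemma bivariate_poly_homogeneous_unproject:
  assumes "homogeneous_polynomial d f" "d \<le> l"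
  shows "bivariate_poly (2 * l) (\<lambda>u v. (1 + u\<^sup>2 + v\<^sup>2) ^ l * f (unproject u v))"
proof -
  have "bivariate_poly 2 (\<lambda>u v. 1 * u ^ 2 * v ^ 0 + (1 * u ^ 0 * v ^ 2 + 1))"
    by (intro bivariate_poly.add_monom bivariate_poly_const) auto
  then have "bivariate_poly 2 (\<lambda>u v. 1 + u\<^sup>2 + v\<^sup>2)"
    by (simp add: add_ac)
  then have "bivariate_poly (2 * l) (\<lambda>u v. (1 + u\<^sup>2 + v\<^sup>2) ^ (l - d) * f (lift u v))"
    using assms bivariate_poly_linear_lift
    by (intro bivariate_poly_mult[OF bivariate_poly_power bivariate_poly_homogeneous_compose]) auto
  moreover have "(1 + u\<^sup>2 + v\<^sup>2) ^ (l - d) * f (lift u v) =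
      (1 + u\<^sup>2 + v\<^sup>2) ^ l * f (unproject u v)" for u v
    using assms by (simp add: lift_eq homogeneous_polynomial_def flip: power_add mult.assoc)
  ultimately show ?thesis by simp
qed

text \<open>The closure of \<open>C\<close> is a compact subset of the sphere without \<open>p\<close>, and in planar coordinates
  \<open>q\<close> vanishes on it outside of \<open>C\<close> but not at a chosen point \<open>a\<close> of \<open>C\<close>. If \<open>\<epsilon> * g\<close> is smaller
  than half of \<open>\<bar>q\<bar>\<close> at \<open>a\<close> throughout the closure, then \<open>q + \<epsilon> * g\<close>, with the sign that makes \<open>q\<close>
  positive at \<open>a\<close>, attains its maximum over the closure inside \<open>C\<close>. As \<open>C\<close> is open in the sphere, this
  is a local maximum along both coordinate lines.\<close>

lemma perturbed_critical_point_in_nodal_domain: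
  assumes C: "C \<in> nodal_domains w" and "p \<notin> C" and "w p \<noteq> 0"
    and cont: "continuous_on (sphere 0 1) w"
    and q: "\<And>u v. q u v = (1 + u\<^sup>2 + v\<^sup>2) ^ l * w (unproject u v)"
    and polys: "bivariate_poly m q" "bivariate_poly n g"
    and q': "\<And>u v. ((\<lambda>u. q u v) has_real_derivative q1 u v) (at u)"
      "\<And>u v. ((\<lambda>v. q u v) has_real_derivative q2 u v) (at v)"
    and g': "\<And>u v. ((\<lambda>u. g u v) has_real_derivative g1 u v) (at u)"
      "\<And>u v. ((\<lambda>v. g u v) has_real_derivative g2 u v) (at v)"
  obtains \<delta> where "\<delta> > 0"
    "\<And>\<epsilon>. 0 < \<epsilon> \<Longrightarrow> \<epsilon> < \<delta> \<Longrightarrow>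
      \<exists>u v. unproject u v \<in> C \<and> q1 u v + \<epsilon> * g1 u v = 0 \<and> q2 u v + \<epsilon> * g2 u v = 0"
proof -
  define N where "N = {x \<in> sphere 0 1. w x \<noteq> 0}"
  have C_comp: "C \<in> components N"
    using C by (simp add: nodal_domains_def N_def)
  have C_N: "C \<subseteq> N" and "C \<noteq> {}"
    using C_comp in_components_subset in_components_nonempty by auto
  have "openin (top_of_set (sphere 0 1)) (sphere 0 1 \<inter> w -` (- {0}))"
    using cont by (intro continuous_openin_preimage_gen) auto
  moreover have "sphere 0 1 \<inter> w -` (- {0}) = N"
    by (auto simp: N_def)
  ultimately have N_open: "openin (top_of_set (sphere 0 1)) N"
    by simp
  moreover have "locally connected (sphere (0 :: real ^ 3) 1)"
    by (rule locally_connected_sphere)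
  ultimately have "locally connected N"
    by (rule locally_open_subset[rotated])
  then have "openin (top_of_set N) C"
    using C_comp by (rule openin_components_locally_connected)
  then have "openin (top_of_set (sphere 0 1)) C"
    using N_open by (rule openin_trans)
  then obtain T where T: "open T" "C = sphere 0 1 \<inter> T"
    by (auto simp: openin_open)

  define K where "K = closure C"
  have C_K: "C \<subseteq> K"
    by (simp add: K_def closure_subset)
  have K_sphere: "K \<subseteq> sphere 0 1"
    using T(2) by (auto simp: K_def intro: closure_minimal[THEN subsetD])
  have K_compact: "compact K"
    using K_sphere bounded_subset[OF bounded_sphere] by (auto simp: K_def compact_eq_bounded_closed)
  have zero: "w x = 0" if "x \<in> K" "x \<notin> C" for x
  proof (rule ccontr)
    assume "w x \<noteq> 0"
    then have "x \<in> N"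
      using that K_sphere by (auto simp: N_def)
    have "closedin (top_of_set N) C"
      using C_comp by (rule closedin_component)
    then obtain D where D: "closed D" "C = N \<inter> D"
      by (auto simp: closedin_closed)
    then have "K \<subseteq> D"
      unfolding K_def by (intro closure_minimal) auto
    with \<open>x \<in> N\<close> D that(1) have "x \<in> C" by blast
    then show False using that by simp
  qed
  \<comment> \<open>This is where \<open>w p \<noteq> 0\<close> keeps the domain away from the pole.\<close>
  have p_K: "p \<notin> K"
    using zero \<open>p \<notin> C\<close> \<open>w p \<noteq> 0\<close> by blast

  define Q where "Q x = q (coord1 x) (coord2 x)" for x
  define G where "G x = g (coord1 x) (coord2 x)" for x
  have Q_cont: "continuous_on K Q" and G_cont: "continuous_on K G"
    unfolding Q_def G_def
    using continuous_on_coord[OF K_sphere p_K] polys by (auto intro: continuous_on_bivariate_poly)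
  have Q_w: "Q x = (1 + (coord1 x)\<^sup>2 + (coord2 x)\<^sup>2) ^ l * w x" if "x \<in> K" for x
    unfolding Q_def q using that K_sphere p_K by (subst unproject_coord) auto
  obtain a where a: "a \<in> C" using \<open>C \<noteq> {}\<close> by blast
  then have "w a \<noteq> 0"
    using C_N by (auto simp: N_def)
  then have Qa: "Q a \<noteq> 0"
    using Q_w[of a] a C_K denominator_pos[of "coord1 a" "coord2 a"] by auto
  obtain B where B: "B > 0" "\<And>x. x \<in> K \<Longrightarrow> \<bar>G x\<bar> \<le> B"
    using compact_imp_bounded[OF compact_continuous_image[OF G_cont K_compact]]
    by (auto simp: bounded_pos)
  show ?thesis
  proof (rule that[of "\<bar>Q a\<bar> / (2 * B)"])
    show "\<bar>Q a\<bar> / (2 * B) > 0"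
      using Qa B by simp
    fix \<epsilon> :: real
    assume \<epsilon>: "0 < \<epsilon>" "\<epsilon> < \<bar>Q a\<bar> / (2 * B)"
    then have \<epsilon>B: "\<epsilon> * B < \<bar>Q a\<bar> / 2"
      using B(1) by (simp add: field_simps)
    define s where "s = sgn (Q a)"
    have s: "s \<noteq> 0" "s * Q a = \<bar>Q a\<bar>" "\<bar>s\<bar> = 1"
      using Qa by (auto simp: s_def sgn_if)
    define F where "F x = s * (Q x + \<epsilon> * G x)" for x
    have "continuous_on K F"
      unfolding F_def using Q_cont G_cont by (intro continuous_intros)
    moreover have "K \<noteq> {}"
      using a C_K by blast
    ultimately obtain b where b: "b \<in> K" "\<And>x. x \<in> K \<Longrightarrow> F x \<le> F b"
      using continuous_attains_sup[OF K_compact, of F] by blast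
    have small: "\<bar>s * (\<epsilon> * G x)\<bar> < \<bar>Q a\<bar> / 2" if "x \<in> K" for x
    proof -
      have "\<bar>s * (\<epsilon> * G x)\<bar> = \<epsilon> * \<bar>G x\<bar>"
        using \<epsilon> s by (simp add: abs_mult)
      also have "\<dots> \<le> \<epsilon> * B"
        using \<epsilon> B(2)[OF that] by simp
      finally show ?thesis using \<epsilon>B by simp
    qed
    have b_C: "b \<in> C"
    proof (rule ccontr)
      assume "b \<notin> C"
      then have "Q b = 0"
        using Q_w zero b(1) by simp
      then have "F b < \<bar>Q a\<bar> / 2"
        using small[OF b(1)] by (simp add: F_def)
      moreover have "F a > \<bar>Q a\<bar> / 2"
        using small[of a] a C_K s by (auto simp: F_def distrib_left)
      ultimately show False
        using b(2)[of a] a C_K by auto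
    qed
    define u0 v0 where uv: "u0 = coord1 b" "v0 = coord2 b"
    have b_eq: "unproject u0 v0 = b"
      unfolding uv using b(1) K_sphere p_K by (intro unproject_coord) auto
    have F_unproject: "F (unproject u v) = s * (q u v + \<epsilon> * g u v)" for u v
      by (simp add: F_def Q_def G_def coord_unproject)
    have F_le: "F (unproject u v) \<le> F b" if "unproject u v \<in> T" for u v
      using b(2) that unproject_in_sphere T(2) C_K by blast
    have "open ((\<lambda>u. unproject u v0) -` T)" "open ((\<lambda>v. unproject u0 v) -` T)"
      by (intro open_vimage[OF T(1)] continuous_on_unproject continuous_on_const continuous_on_id)+
    moreover have "u0 \<in> (\<lambda>u. unproject u v0) -` T" "v0 \<in> (\<lambda>v. unproject u0 v) -` T"
      using b_eq b_C T(2) by auto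
    ultimately obtain d1 d2 where d: "d1 > 0" "ball u0 d1 \<subseteq> (\<lambda>u. unproject u v0) -` T"
      "d2 > 0" "ball v0 d2 \<subseteq> (\<lambda>v. unproject u0 v) -` T"
      by (meson open_contains_ball)
    have "s * (q1 u0 v0 + \<epsilon> * g1 u0 v0) = 0"
    proof (rule DERIV_local_max[OF _ d(1)])
      show "((\<lambda>u. s * (q u v0 + \<epsilon> * g u v0)) has_real_derivative
          s * (q1 u0 v0 + \<epsilon> * g1 u0 v0)) (at u0)"
        using q' g' by (auto intro!: derivative_eq_intros)
      show "\<forall>u. \<bar>u0 - u\<bar> < d1 \<longrightarrow> s * (q u v0 + \<epsilon> * g u v0) \<le> s * (q u0 v0 + \<epsilon> * g u0 v0)"
        using d(2) F_le b_eq by (auto simp: dist_real_def subset_iff simp flip: F_unproject)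
    qed
    moreover have "s * (q2 u0 v0 + \<epsilon> * g2 u0 v0) = 0"
    proof (rule DERIV_local_max[OF _ d(3)])
      show "((\<lambda>v. s * (q u0 v + \<epsilon> * g u0 v)) has_real_derivative
          s * (q2 u0 v0 + \<epsilon> * g2 u0 v0)) (at v0)"
        using q' g' by (auto intro!: derivative_eq_intros)
      show "\<forall>v. \<bar>v0 - v\<bar> < d2 \<longrightarrow> s * (q u0 v + \<epsilon> * g u0 v) \<le> s * (q u0 v0 + \<epsilon> * g u0 v0)"
        using d(4) F_le b_eq by (auto simp: dist_real_def subset_iff simp flip: F_unproject)
    qed
    ultimately show "\<exists>u v. unproject u v \<in> C \<and> q1 u v + \<epsilon> * g1 u v = 0 \<and> q2 u v + \<epsilon> * g2 u v = 0"
      using s(1) b_eq b_C by (intro exI[of _ u0] exI[of _ v0]) auto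
  qed
qed

text \<open>It suffices to bound the size of a finite collection of these domains, for which one \<open>\<epsilon>\<close> suits
  all members. Distinct domains are disjoint, so critical points of the perturbed polynomial chosen in
  them are distinct. The exponent \<open>m + 1\<close> in the perturbation is the least for which its derivative
  dominates those of \<open>q\<close>, whose degree is at most \<open>m - 1\<close>.\<close>

lemma card_nodal_domains_avoiding_pole:
  assumes "w p \<noteq> 0" and cont: "continuous_on (sphere 0 1) w" and "l > 0"
    and poly: "bivariate_poly (2 * l) (\<lambda>u v. (1 + u\<^sup>2 + v\<^sup>2) ^ l * w (unproject u v))"
  shows "finite {C \<in> nodal_domains w. p \<notin> C} \<and> card {C \<in> nodal_domains w. p \<notin> C} \<le> (2 * l)\<^sup>2"
proof (rule finite_if_finite_subsets_card_bdd)
  fix \<C> assume sub: "\<C> \<subseteq> {C \<in> nodal_domains w. p \<notin> C}" and fin: "finite \<C>"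
  define m where "m = 2 * l"
  define q where "q u v = (1 + u\<^sup>2 + v\<^sup>2) ^ l * w (unproject u v)" for u v
  define g where "g u v = u ^ (m + 1) + v ^ (m + 1)" for u v :: real
  have q: "bivariate_poly m q"
    using poly by (simp add: m_def q_def[abs_def])
  have g: "bivariate_poly (m + 1) g"
    using bivariate_poly_add[OF bivariate_poly_monom[of "m + 1" 0 "m + 1" 1] bivariate_poly_monom[of 0 "m + 1" "m + 1" 1]]
    by (simp add: g_def[abs_def])
  have power: "((\<lambda>t. t ^ (m + 1) + k) has_real_derivative (1 + real m) * t ^ m) (at t)" for t k :: real
    using DERIV_add[OF DERIV_pow[of "m + 1" t] DERIV_const] by simp
  have g1: "((\<lambda>u. g u v) has_real_derivative (1 + real m) * u ^ m) (at u)" for u v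
    unfolding g_def by (rule power)
  have g2: "((\<lambda>v. g u v) has_real_derivative (1 + real m) * v ^ m) (at v)" for u v
    unfolding g_def add.commute[of "u ^ _"] by (rule power)
  obtain q1 where q1: "bivariate_poly (m - 1) q1"
    "\<And>u v. ((\<lambda>u. q u v) has_real_derivative q1 u v) (at u)"
    using bivariate_poly_deriv_fst[OF q] by blast
  obtain q2 where q2: "bivariate_poly (m - 1) q2"
    "\<And>u v. ((\<lambda>v. q u v) has_real_derivative q2 u v) (at v)"
    using bivariate_poly_deriv_snd[OF q] by blast
  define crit where "crit \<epsilon> C u v \<longleftrightarrow> unproject u v \<in> C \<and>
    q1 u v + \<epsilon> * ((1 + real m) * u ^ m) = 0 \<and> q2 u v + \<epsilon> * ((1 + real m) * v ^ m) = 0" for \<epsilon> C u v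
  have "\<exists>\<delta>>0. \<forall>\<epsilon>. 0 < \<epsilon> \<and> \<epsilon> < \<delta> \<longrightarrow> (\<exists>u v. crit \<epsilon> C u v)" if "C \<in> \<C>" for C
  proof -
    have "C \<in> nodal_domains w" "p \<notin> C"
      using that sub by auto
    from perturbed_critical_point_in_nodal_domain[OF this assms(1) cont q_def q g q1(2) q2(2) g1 g2]
    show ?thesis
      unfolding crit_def by metis
  qed
  then obtain \<delta> where \<delta>: "\<And>C. C \<in> \<C> \<Longrightarrow> \<delta> C > 0"
    "\<And>C \<epsilon>. C \<in> \<C> \<Longrightarrow> 0 < \<epsilon> \<Longrightarrow> \<epsilon> < \<delta> C \<Longrightarrow> \<exists>u v. crit \<epsilon> C u v"
    by metis
  define \<epsilon> where "\<epsilon> = Min (insert 1 (\<delta> ` \<C>)) / 2"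
  have "Min (insert 1 (\<delta> ` \<C>)) > 0"
    using fin \<delta>(1) by simp
  moreover have "Min (insert 1 (\<delta> ` \<C>)) \<le> \<delta> C" if "C \<in> \<C>" for C
    using fin that by simp
  ultimately have \<epsilon>: "\<epsilon> > 0" "\<And>C. C \<in> \<C> \<Longrightarrow> \<epsilon> < \<delta> C"
    unfolding \<epsilon>_def by (simp, force)
  have "\<exists>z. crit \<epsilon> C (fst z) (snd z)" if "C \<in> \<C>" for C
    using \<delta>(2)[OF that \<epsilon>(1) \<epsilon>(2)[OF that]] by simp
  then obtain z where z: "\<And>C. C \<in> \<C> \<Longrightarrow> crit \<epsilon> C (fst (z C)) (snd (z C))"
    using bchoice[of \<C> "\<lambda>C z. crit \<epsilon> C (fst z) (snd z)"] by blast
  have "inj_on z \<C>"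
  proof (rule inj_onI)
    fix C D assume CD: "C \<in> \<C>" "D \<in> \<C>" "z C = z D"
    then have "C \<inter> D \<noteq> {}"
      using z[of C] z[of D] by (auto simp: crit_def)
    moreover have "C \<in> components {x \<in> sphere 0 1. w x \<noteq> 0}" "D \<in> components {x \<in> sphere 0 1. w x \<noteq> 0}"
      using CD sub by (auto simp: nodal_domains_def)
    ultimately show "C = D"
      using components_nonoverlap by blast
  qed
  moreover have "card (z ` \<C>) \<le> m\<^sup>2"
  proof (rule card_common_zeros_le[OF q1(1) q2(1)])
    show "m > 0" "- (\<epsilon> * (1 + real m)) \<noteq> 0" "finite (z ` \<C>)"
      using \<open>l > 0\<close> \<epsilon> fin by (auto simp: m_def)
    fix u v assume "(u, v) \<in> z ` \<C>"
    then obtain C where "C \<in> \<C>" "(u, v) = z C" by blast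
    then have "crit \<epsilon> C u v"
      using z[of C] by (metis fst_conv snd_conv)
    then show "- (\<epsilon> * (1 + real m)) * u ^ m = q1 u v" "- (\<epsilon> * (1 + real m)) * v ^ m = q2 u v"
      by (simp_all add: crit_def algebra_simps)
  qed
  ultimately show "card \<C> \<le> (2 * l)\<^sup>2"
    by (simp add: card_image m_def)
qed

end

section \<open>Nodal domains of sums of spherical harmonics\<close>

theorem corollaryA2:
  fixes l :: nat and I :: "'i set" and d :: "'i \<Rightarrow> nat"
    and Y :: "'i \<Rightarrow> real ^ 3 \<Rightarrow> real" and w :: "real ^ 3 \<Rightarrow> real"
  assumes "l \<ge> 1"
    and "finite I"
    and "\<And>i. i \<in> I \<Longrightarrow> d i \<le> l"
    and "\<And>i. i \<in> I \<Longrightarrow> spherical_harmonic (d i) (Y i)"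
    and "\<And>x. x \<in> sphere 0 1 \<Longrightarrow> w x = (\<Sum>i\<in>I. Y i x)"
  shows "finite (nodal_domains w) \<and> card (nodal_domains w) \<le> 8 * l ^ 2"
proof (cases "\<exists>p\<in>sphere 0 1. w p \<noteq> 0")
  case False
  then have "nodal_domains w = {}"
    by (auto simp: nodal_domains_def)
  then show ?thesis by simp
next
  case True
  then obtain p where p: "p \<in> sphere 0 1" "w p \<noteq> 0" by blast
  then obtain e1 e2 where "orthonormal_frame e1 e2 p"
    using orthonormal_frame_exists by blast
  then interpret orthonormal_frame e1 e2 p .
  obtain P where P: "\<And>i. i \<in> I \<Longrightarrow> homogeneous_polynomial (d i) (P i)"
    "\<And>i x. i \<in> I \<Longrightarrow> x \<in> sphere 0 1 \<Longrightarrow> Y i x = P i x"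
    using assms(4) unfolding spherical_harmonic_def by metis
  have w: "w x = (\<Sum>i\<in>I. P i x)" if "x \<in> sphere 0 1" for x
    using assms(5)[OF that] P(2)[OF _ that] by simp
  have "continuous_on (sphere 0 1) (\<lambda>x. \<Sum>i\<in>I. P i x)"
    using P(1) by (intro continuous_on_sum continuous_on_polymonial_function)
      (auto simp: homogeneous_polynomial_def real_polynomial_function_eq)
  then have cont: "continuous_on (sphere 0 1) w"
    by (rule continuous_on_eq) (simp only: w)
  have "bivariate_poly (2 * l) (\<lambda>u v. \<Sum>i\<in>I. (1 + u\<^sup>2 + v\<^sup>2) ^ l * P i (unproject u v))"
    using P(1) assms(3) by (intro bivariate_poly_sum bivariate_poly_homogeneous_unproject) auto
  then have "bivariate_poly (2 * l) (\<lambda>u v. (1 + u\<^sup>2 + v\<^sup>2) ^ l * w (unproject u v))"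
    by (simp add: w[OF unproject_in_sphere] sum_distrib_left)
  then have avoid: "finite {C \<in> nodal_domains w. p \<notin> C}"
    "card {C \<in> nodal_domains w. p \<notin> C} \<le> (2 * l)\<^sup>2"
    using card_nodal_domains_avoiding_pole[OF p(2) cont, of l] assms(1) by simp_all
  define C0 where "C0 = connected_component_set {x \<in> sphere 0 1. w x \<noteq> 0} p"
  have "C = C0" if "C \<in> nodal_domains w" "p \<in> C" for C
    using that connected_component_eq unfolding nodal_domains_def C0_def components_def by blast
  then have sub: "nodal_domains w \<subseteq> insert C0 {C \<in> nodal_domains w. p \<notin> C}"
    by blast
  then have "finite (nodal_domains w)"
    using avoid(1) by (meson finite_insert finite_subset)
  have "card (nodal_domains w) \<le> card (insert C0 {C \<in> nodal_domains w. p \<notin> C})"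
    using sub avoid(1) by (intro card_mono) auto
  also have "\<dots> \<le> Suc (card {C \<in> nodal_domains w. p \<notin> C})"
    using avoid(1) by (simp add: card_insert_if)
  also have "\<dots> \<le> Suc ((2 * l)\<^sup>2)"
    using avoid(2) by simp
  finally have "card (nodal_domains w) \<le> Suc ((2 * l)\<^sup>2)" .
  moreover have "l\<^sup>2 \<ge> 1"
    using assms(1) by simp
  ultimately show ?thesis
    using \<open>finite (nodal_domains w)\<close> by (simp add: power_mult_distrib)
qed

end
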